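(* Let $\mathcal{A}$ be a finite alphabet and let $\Theta_1:\mathcal{A}^*\to\mathcal{A}^*$ be an involutive antimorphism. Let $\mathbf{u}\in\mathcal{A}^{\mathbb{N}}$ be a recurrent infinite word such that $D_{\Theta_1}(\mathbf{u})<+\infty$. Then there exist a finite alphabet $\mathcal{B}$, an involutive antimorphism $\Theta_2:\mathcal{B}^*\to\mathcal{B}^*$, a morphism $\varphi:\mathcal{B}^*\to\mathcal{A}^*$ and a recurrent infinite word $\mathbf{v}\in\mathcal{B}^{\mathbb{N}}$ such that $\mathbf{u}=\varphi(\mathbf{v})$ and $\mathbf{v}$ is $\Theta_2$-rich.
   Context: An involutive antimorphism on $\mathcal{A}^*$ is a map $\Theta:\mathcal{A}^*\to\mathcal{A}^*$ with $\Theta^2=\mathrm{Id}$ and $\Theta(uv)=\Theta(v)\Theta(u)$ for all $u,v\in\mathcal{A}^*$. A word $w$ is a $\Theta$-palindrome if $\Theta(w)=w$ (the empty word is one). For a finite word $w$, $\mathrm{Pal}_\Theta(w)$ is the set of distinct $\Theta$-palindromes occurring as factors of $w$ (including the empty word), and $G_\Theta(w)$ is the number of sets $\{a,\Theta(a)\}$ where $a$ is a letter occurring in $w$ with $a\neq\Theta(a)$. The $\Theta$-palindromic defect of a finite word $w$ is $D_\Theta(w)=|w|+1-G_\Theta(w)-\#\mathrm{Pal}_\Theta(w)$ (always $\ge 0$), and for an infinite word $\mathbf{u}$, $D_\Theta(\mathbf{u})=\sup\{D_\Theta(w): w \text{ a factor of } \mathbf{u}\}$. A finite word $w$ is $\Theta$-rich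 if $D_\Theta(w)=0$; an infinite word is $\Theta$-rich if all its factors are $\Theta$-rich. An infinite word is recurrent if every factor occurs in it infinitely many times. For a morphism $\varphi$ and infinite word $\mathbf{v}=v_0v_1\cdots$, $\varphi(\mathbf{v})=\varphi(v_0)\varphi(v_1)\cdots$. *)

theory Defs
  imports Main
begin

definition inv_antimorph :: "'a set \<Rightarrow> ('a list \<Rightarrow> 'a list) \<Rightarrow> bool" where
  "inv_antimorph A \<Theta> \<longleftrightarrow>
     (\<forall>x \<in> lists A. \<Theta> x \<in> lists A \<and> \<Theta> (\<Theta> x) = x) \<and>
     (\<forall>x \<in> lists A. \<forall>y \<in> lists A. \<Theta> (x @ y) = \<Theta> y @ \<Theta> x)"

definition is_pal :: "('a list \<Rightarrow> 'a list) \<Rightarrow> 'a list \<Rightarrow> bool" where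
  "is_pal \<Theta> w \<longleftrightarrow> \<Theta> w = w"

definition factors :: "'a list \<Rightarrow> 'a list set" where
  "factors w = {x. \<exists>p s. w = p @ x @ s}"

definition Pal :: "('a list \<Rightarrow> 'a list) \<Rightarrow> 'a list \<Rightarrow> 'a list set" where
  "Pal \<Theta> w = {x \<in> factors w. is_pal \<Theta> x}"

definition G :: "('a list \<Rightarrow> 'a list) \<Rightarrow> 'a list \<Rightarrow> nat" where
  "G \<Theta> w = card {{[a], \<Theta> [a]} | a. a \<in> set w \<and> \<Theta> [a] \<noteq> [a]}"

definition defect :: "('a list \<Rightarrow> 'a list) \<Rightarrow> 'a list \<Rightarrow> int" where
  "defect \<Theta> w = int (length w) + 1 - int (G \<Theta> w) - int (card (Pal \<Theta> w))"

definition occurs_at :: "(nat \<Rightarrow> 'a) \<Rightarrow> 'a list \<Rightarrow> nat \<Rightarrow> bool" where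
  "occurs_at u w i \<longleftrightarrow> w = map u [i..<i + length w]"

definition inf_factor :: "'a list \<Rightarrow> (nat \<Rightarrow> 'a) \<Rightarrow> bool" where
  "inf_factor w u \<longleftrightarrow> (\<exists>i. occurs_at u w i)"

definition recurrent :: "(nat \<Rightarrow> 'a) \<Rightarrow> bool" where
  "recurrent u \<longleftrightarrow> (\<forall>w. inf_factor w u \<longrightarrow> infinite {i. occurs_at u w i})"

definition finite_defect :: "('a list \<Rightarrow> 'a list) \<Rightarrow> (nat \<Rightarrow> 'a) \<Rightarrow> bool" where
  "finite_defect \<Theta> u \<longleftrightarrow> (\<exists>N::int. \<forall>w. inf_factor w u \<longrightarrow> defect \<Theta> w \<le> N)"

definition rich_inf :: "('a list \<Rightarrow> 'a list) \<Rightarrow> (nat \<Rightarrow> 'a) \<Rightarrow> bool" where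
  "rich_inf \<Theta> u \<longleftrightarrow> (\<forall>w. inf_factor w u \<longrightarrow> defect \<Theta> w = 0)"

text \<open>Image of an infinite word v under the morphism with letter images f:
  phi(v) = f(v0) f(v1) ...; u = phi(v) means every finite prefix image is a
  prefix of u and these prefixes are unboundedly long (so phi(v) is infinite and equals u).\<close>
definition morph_image_eq :: "('b \<Rightarrow> 'a list) \<Rightarrow> (nat \<Rightarrow> 'b) \<Rightarrow> (nat \<Rightarrow> 'a) \<Rightarrow> bool" where
  "morph_image_eq f v u \<longleftrightarrow>
     (\<forall>n. let w = concat (map f (map v [0..<n])) in w = map u [0..<length w]) \<and>
     (\<forall>m. \<exists>n. length (concat (map f (map v [0..<n]))) \<ge> m)"

end

theory Submission
  imports Defs "HOL-Library.Sublist" "HOL-Library.Countable" "HOL-Library.Infinite_Set"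
begin

text \<open>
  Appending a letter never lowers the defect, and it keeps the defect exactly when it creates a new
  palindromic suffix or opens a new pair \<open>{a, \<Theta> a}\<close>. Let \<open>z\<close> be a factor of \<open>u\<close> of maximal
  defect. Reading \<open>u\<close> from an occurrence of \<open>z\<close> on, every letter whose pair is already open creates
  a new palindromic suffix. Let \<open>|w| > |z|\<close> and let \<open>e\<close> be a factor that starts with \<open>w\<close> or \<open>\<Theta> w\<close>,
  ends with \<open>w\<close>, is longer than \<open>w\<close> and has minimal length. Since \<open>e\<close> does not fit into \<open>z\<close>, the
  first occurrence of \<open>e\<close> or \<open>\<Theta> e\<close> after \<open>z\<close> creates a new palindrome, and this forces a palindromic
  suffix of \<open>e\<close> longer than \<open>w\<close>.

  Hence for \<open>N = |z| + 1\<close> the \<open>N\<close>-block coding of \<open>u\<close>, whose \<open>i\<close>-th letter is the factor of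
  length \<open>N\<close> at position \<open>i\<close>, is rich for the antimorphism that applies \<open>\<Theta>\<close> to each block:
  palindromes of length \<open>k \<ge> 1\<close> of the coding are palindromes of length \<open>k + N - 1\<close> of \<open>u\<close>. The
  morphism sends a block to its first letter.
\<close>

section \<open>Factors, prefixes and suffixes of finite words\<close>

lemma factors_eq_sublist: "factors w = {x. sublist x w}"
  by (auto simp: factors_def sublist_def)

lemma sublist_single: "sublist [a] x \<longleftrightarrow> a \<in> set x"
  by (auto simp: sublist_def in_set_conv_decomp)

lemma prefix_butlast:
  assumes "prefix x y" "length x < length y"
  shows "prefix x (butlast y)"
proof -
  obtain s where s: "y = x @ s" using assms(1) by (auto simp: prefix_def)
  then have "s \<noteq> []" using assms(2) by auto
  then show ?thesis using s by (simp add: butlast_append)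
qed

lemma suffix_butlast:
  assumes "suffix x y" "x \<noteq> []"
  shows "suffix (butlast x) (butlast y)"
  using assms by (auto simp: suffix_def butlast_append)

section \<open>Involutive antimorphisms on words\<close>

locale antimorphism =
  fixes \<Theta> :: "'a list \<Rightarrow> 'a list"
  assumes inv: "inv_antimorph UNIV \<Theta>"
begin

lemma invol [simp]: "\<Theta> (\<Theta> x) = x"
  and anti: "\<Theta> (x @ y) = \<Theta> y @ \<Theta> x"
  using inv by (auto simp: inv_antimorph_def)

lemma image_Nil [simp]: "\<Theta> [] = []"
  using anti[of "[]" "[]"] by simp

text \<open>An involution that fixes \<open>[]\<close> sends no letter to \<open>[]\<close>, so
  lengths cannot shrink. Used for both \<open>x\<close> and \<open>\<Theta> x\<close>, this makes
  the lengths equal.\<close>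

lemma length_ge: "length x \<le> length (\<Theta> x)"
proof (induction x)
  case (Cons a x)
  have "\<Theta> [a] \<noteq> []" by (metis image_Nil invol list.discI)
  then have "1 \<le> length (\<Theta> [a])" by (cases "\<Theta> [a]") auto
  then show ?case using anti[of "[a]" x] Cons by simp
qed simp

lemma length_image [simp]: "length (\<Theta> x) = length x"
  using length_ge[of x] length_ge[of "\<Theta> x"] by simp

lemma suffix_imp_prefix: "suffix x y \<Longrightarrow> prefix (\<Theta> x) (\<Theta> y)"
  by (auto simp: suffix_def prefix_def anti)

lemma prefix_imp_suffix: "prefix x y \<Longrightarrow> suffix (\<Theta> x) (\<Theta> y)"
  by (auto simp: suffix_def prefix_def anti)

lemma sublist_image: "sublist x y \<Longrightarrow> sublist (\<Theta> x) (\<Theta> y)"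
proof -
  assume "sublist x y"
  then obtain p s where "y = p @ x @ s" by (auto simp: sublist_def)
  then have "\<Theta> y = \<Theta> s @ \<Theta> x @ \<Theta> p" by (simp add: anti)
  then show ?thesis by (auto simp: sublist_def)
qed

lemma letter: obtains b where "\<Theta> [a] = [b]" "\<Theta> [b] = [a]"
proof -
  have "length (\<Theta> [a]) = 1" by simp
  then obtain b where "\<Theta> [a] = [b]" by (metis One_nat_def length_0_conv length_Suc_conv)
  then show ?thesis using that invol[of "[a]"] by metis
qed

section \<open>Unioccurrent palindromic suffixes\<close>

definition new_pal :: "'a list \<Rightarrow> 'a list \<Rightarrow> bool" where
  "new_pal p w \<longleftrightarrow> is_pal \<Theta> p \<and> suffix p w \<and> \<not> sublist p (butlast w)"

lemma new_pal_not_Nil: "new_pal p w \<Longrightarrow> p \<noteq> []"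
  by (auto simp: new_pal_def)

text \<open>The shorter of two palindromic suffixes is a suffix of the longer one and, by applying
  \<open>\<Theta>\<close>, also a prefix of it. It therefore occurs before the end of
  \<open>w\<close> and is not new.\<close>

lemma new_pal_unique:
  assumes "new_pal p w" "new_pal q w"
  shows "p = q"
proof -
  have *: False if "new_pal p w" "new_pal q w" "length p < length q" for p q
  proof -
    have "suffix p q"
      using that suffix_length_suffix[of p w q] by (auto simp: new_pal_def)
    then have "prefix p q"
      using suffix_imp_prefix that by (fastforce simp: new_pal_def is_pal_def)
    then obtain s where s: "q = p @ s" by (auto simp: prefix_def)
    then have "s \<noteq> []" using that(3) by auto
    moreover obtain r where "w = r @ q" using \<open>new_pal q w\<close> unfolding new_pal_def suffix_def by blast
    ultimately have "butlast w = r @ p @ butlast s" using s by (simp add: butlast_append)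
    then show False using that(1) by (auto simp: new_pal_def sublist_def)
  qed
  have "length p = length q" using *[of p q] *[of q p] assms by force
  then show ?thesis using assms
    by (metis new_pal_def suffix_order.antisym suffix_length_suffix order_refl)
qed

lemma finite_Pal: "finite (Pal \<Theta> w)"
proof (rule finite_subset)
  show "Pal \<Theta> w \<subseteq> set (sublists w)"
    by (auto simp: Pal_def factors_eq_sublist)
qed simp

lemma Pal_snoc: "Pal \<Theta> (x @ [a]) = Pal \<Theta> x \<union> {p. new_pal p (x @ [a])}"
  by (auto simp: Pal_def factors_eq_sublist sublist_snoc new_pal_def)

lemma Pal_disjoint: "p \<in> Pal \<Theta> x \<Longrightarrow> \<not> new_pal p (x @ [a])"
  by (auto simp: Pal_def factors_eq_sublist new_pal_def)

lemma card_Pal_snoc_new: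
  assumes "new_pal p (x @ [a])"
  shows "card (Pal \<Theta> (x @ [a])) = Suc (card (Pal \<Theta> x))"
proof -
  have "Pal \<Theta> (x @ [a]) = insert p (Pal \<Theta> x)"
    using Pal_snoc assms new_pal_unique by blast
  then show ?thesis using Pal_disjoint assms finite_Pal by (metis card_insert_disjoint)
qed

lemma Pal_snoc_old:
  assumes "\<nexists>p. new_pal p (x @ [a])"
  shows "Pal \<Theta> (x @ [a]) = Pal \<Theta> x"
  using Pal_snoc assms by blast

section \<open>Letter pairs and the growth of the defect\<close>

definition fresh :: "'a list \<Rightarrow> 'a \<Rightarrow> bool" where
  "fresh x a \<longleftrightarrow> \<not> sublist [a] x \<and> \<not> sublist (\<Theta> [a]) x"

definition pairs :: "'a list \<Rightarrow> 'a list set set" where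
  "pairs x = {{[a], \<Theta> [a]} | a. a \<in> set x \<and> \<Theta> [a] \<noteq> [a]}"

lemma G_eq: "G \<Theta> x = card (pairs x)"
  by (simp add: G_def pairs_def)

lemma finite_pairs: "finite (pairs x)"
  by (simp add: pairs_def)

lemma pairs_snoc:
  "pairs (x @ [a]) = pairs x \<union> (if \<Theta> [a] = [a] then {} else {{[a], \<Theta> [a]}})"
  by (auto simp: pairs_def)

lemma in_pairs:
  assumes "\<Theta> [a] \<noteq> [a]"
  shows "{[a], \<Theta> [a]} \<in> pairs x \<longleftrightarrow> \<not> fresh x a"
proof -
  obtain b where b: "\<Theta> [a] = [b]" "\<Theta> [b] = [a]" using letter .
  show ?thesis
  proof
    assume "{[a], \<Theta> [a]} \<in> pairs x"
    then obtain c where c: "c \<in> set x" "{[a], [b]} = {[c], \<Theta> [c]}"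
      using b by (auto simp: pairs_def)
    then have "c = a \<or> c = b" by (auto simp: doubleton_eq_iff)
    then show "\<not> fresh x a" using b c(1) by (auto simp: fresh_def sublist_single)
  next
    assume "\<not> fresh x a"
    then have "a \<in> set x \<or> b \<in> set x" using b by (auto simp: fresh_def sublist_single)
    then show "{[a], \<Theta> [a]} \<in> pairs x"
    proof
      assume "b \<in> set x"
      then have "{[b], \<Theta> [b]} \<in> pairs x" using b assms by (auto simp: pairs_def)
      then show ?thesis using b by (simp add: insert_commute)
    qed (use assms in \<open>auto simp: pairs_def\<close>)
  qed
qed

lemma G_snoc:
  "G \<Theta> (x @ [a]) = G \<Theta> x + (if \<Theta> [a] \<noteq> [a] \<and> fresh x a then 1 else 0)"
  using in_pairs[of a x] finite_pairs[of x]
  by (auto simp: G_eq pairs_snoc insert_absorb)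

text \<open>A nonempty palindrome ending in \<open>a\<close> begins with
  \<open>\<Theta> [a]\<close>, which differs from \<open>[a]\<close> and so would have to occur in
  \<open>x\<close>. Hence one appended letter never raises both \<open>G\<close> and the number of
  palindromes.\<close>

lemma fresh_no_new_pal:
  assumes "\<Theta> [a] \<noteq> [a]" "fresh x a"
  shows "\<not> new_pal p (x @ [a])"
proof
  assume p: "new_pal p (x @ [a])"
  then have "p \<noteq> []" by (rule new_pal_not_Nil)
  with p have "suffix [a] p"
    by (metis new_pal_def append_butlast_last_id last_snoc suffixI suffix_def last_appendR)
  then have "prefix (\<Theta> [a]) p"
    using suffix_imp_prefix p by (fastforce simp: new_pal_def is_pal_def)
  then have "sublist (\<Theta> [a]) (x @ [a])"
    using p by (meson new_pal_def prefix_imp_sublist suffix_imp_sublist sublist_order.order_trans)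
  moreover have "\<not> suffix (\<Theta> [a]) (x @ [a])"
    using assms(1) letter[of a] by (metis suffix_snoc append_Nil last_snoc not_Cons_self2)
  ultimately show False using assms(2) by (auto simp: sublist_snoc fresh_def simp del: suffix_snoc)
qed

text \<open>The length grows by one, and at most one of the two subtracted counts grows, by at most
  one.\<close>

lemma defect_snoc_ge: "defect \<Theta> x \<le> defect \<Theta> (x @ [a])"
proof (cases "\<exists>p. new_pal p (x @ [a])")
  case True
  then have "\<not> (\<Theta> [a] \<noteq> [a] \<and> fresh x a)" using fresh_no_new_pal by blast
  with True show ?thesis using card_Pal_snoc_new by (auto simp: defect_def G_snoc)
next
  case False
  then show ?thesis using Pal_snoc_old by (auto simp: defect_def G_snoc)
qed

lemma defect_append_ge: "defect \<Theta> x \<le> defect \<Theta> (x @ y)"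
proof (induction y rule: rev_induct)
  case (snoc a y)
  then show ?case using defect_snoc_ge[of "x @ y" a] by simp
qed simp

lemma defect_Nil [simp]: "defect \<Theta> [] = 0"
proof -
  have "Pal \<Theta> [] = {[]}" by (auto simp: Pal_def factors_eq_sublist is_pal_def)
  then show ?thesis by (simp add: defect_def G_def)
qed

lemma defect_nonneg: "0 \<le> defect \<Theta> x"
  using defect_append_ge[of "[]" x] by simp

lemma ex_new_pal:
  assumes "defect \<Theta> (x @ [a]) \<le> defect \<Theta> x" "\<not> fresh x a"
  shows "\<exists>p. new_pal p (x @ [a])"
  using assms Pal_snoc_old by (fastforce simp: defect_def G_snoc)

text \<open>The criterion by which the block coding is shown rich, letter by letter; the preceding
  lemma is the opposite direction and serves for \<open>u\<close>.\<close>

lemma defect_snoc_eq: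
  assumes "\<not> fresh x a \<Longrightarrow> \<exists>p. new_pal p (x @ [a])"
  shows "defect \<Theta> (x @ [a]) = defect \<Theta> x"
proof (cases "\<exists>p. new_pal p (x @ [a])")
  case True
  then have "\<not> (\<Theta> [a] \<noteq> [a] \<and> fresh x a)" using fresh_no_new_pal by blast
  with True show ?thesis using card_Pal_snoc_new by (auto simp: defect_def G_snoc)
next
  case False
  then have "fresh x a" using assms by blast
  \<comment> \<open>If \<open>\<Theta> [a] = [a]\<close>, the fresh \<open>[a]\<close> would itself
    be a new palindromic suffix.\<close>
  moreover from this False have "\<Theta> [a] \<noteq> [a]"
    by (auto simp: new_pal_def is_pal_def suffix_def fresh_def)
  ultimately show ?thesis using False Pal_snoc_old by (auto simp: defect_def G_snoc)
qed

end

section \<open>Slices of an infinite word\<close>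

lemma map_upt_sublistE:
  assumes "sublist e (map u [i..<k])" "i \<le> k"
  obtains j where "i \<le> j" "j + length e \<le> k" "e = map u [j..<j + length e]"
proof -
  obtain p s where ps: "map u [i..<k] = p @ e @ s" using assms by (auto simp: sublist_def)
  then have l: "k - i = length p + length e + length s"
    by (metis length_append length_map length_upt add.assoc)
  have "e = take (length e) (drop (length p) (map u [i..<k]))" using ps by simp
  also have "\<dots> = map u [i + length p..<i + length p + length e]"
    using l assms(2) by (simp add: drop_map take_map drop_upt take_upt)
  finally have *: "e = map u [i + length p..<i + length p + length e]" .
  show ?thesis by (rule that[OF _ _ *]) (use l assms in auto)
qed

lemma map_upt_split:
  assumes "i \<le> j" "j \<le> k"
  shows "map u [i..<k] = map u [i..<j] @ map u [j..<k]"
  using assms by (metis le_add_diff_inverse map_append upt_add_eq_append)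

lemma map_upt_sublist:
  assumes "i \<le> j" "j + m \<le> k"
  shows "sublist (map u [j..<j + m]) (map u [i..<k])"
proof -
  have "map u [i..<k] = map u [i..<j] @ map u [j..<j+m] @ map u [j+m..<k]"
    using assms by (simp add: map_upt_split[of i j k] map_upt_split[of j "j+m" k])
  then show ?thesis by (metis sublist_appendI)
qed

lemma map_upt_suffixE:
  assumes "suffix p (map u [i..<k])" "i \<le> k"
  obtains j where "i \<le> j" "j \<le> k" "p = map u [j..<k]"
proof -
  obtain q where q: "map u [i..<k] = q @ p" using assms by (auto simp: suffix_def)
  then have "length q \<le> k - i" by (metis length_append length_map length_upt le_add1)
  moreover have "p = drop (length q) (map u [i..<k])" using q by simp
  ultimately show ?thesis using that[of "i + length q"] assms(2)
    by (simp add: drop_map drop_upt)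
qed

section \<open>Palindromic suffixes in a recurrent word of finite defect\<close>

locale finite_defect_word = antimorphism \<Theta> for \<Theta> :: "'a list \<Rightarrow> 'a list" +
  fixes u :: "nat \<Rightarrow> 'a"
  assumes rec: "recurrent u" and fin: "finite_defect \<Theta> u"
begin

lemma max_defect:
  obtains i m where "\<And>w. inf_factor w u \<Longrightarrow> defect \<Theta> w \<le> defect \<Theta> (map u [i..<i + m])"
proof -
  obtain N where N: "\<And>w. inf_factor w u \<Longrightarrow> defect \<Theta> w \<le> N"
    using fin by (auto simp: finite_defect_def)
  have "inf_factor [] u" by (auto simp: inf_factor_def occurs_at_def)
  \<comment> \<open>The maximum is taken over naturals; \<open>nat\<close> changes no value, since
    defects are nonnegative.\<close>
  then have "\<exists>z. inf_factor z u \<and> (\<forall>y. inf_factor y u \<longrightarrow> nat (defect \<Theta> y) \<le> nat (defect \<Theta> z))"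
    by (rule ex_has_greatest_nat[where b = "nat N + 1"]) (auto dest: N)
  then obtain z where z: "inf_factor z u" "\<And>y. inf_factor y u \<Longrightarrow> nat (defect \<Theta> y) \<le> nat (defect \<Theta> z)"
    by blast
  then obtain i where "z = map u [i..<i + length z]" by (auto simp: inf_factor_def occurs_at_def)
  with z(2) show ?thesis using that[of i "length z"] defect_nonneg by (simp add: nat_le_eq_zle)
qed

text \<open>Cutting \<open>u\<close> at a factor of maximal defect and reading on until \<open>e\<close> or its image first
  appears yields a word in which that occurrence is the only one.\<close>

lemma new_pal_at_first_occurrence:
  obtains n where
    "\<And>e. \<lbrakk>inf_factor e u; n < length e; \<not> fresh (butlast e) (last e); \<not> fresh (butlast (\<Theta> e)) (last (\<Theta> e))\<rbrakk>
      \<Longrightarrow> \<exists>X e' p. e' \<in> {e, \<Theta> e} \<and> suffix e' X \<and> \<not> sublist e (butlast X) \<and>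
            \<not> sublist (\<Theta> e) (butlast X) \<and> new_pal p X"
proof -
  obtain i m where mx: "\<And>w. inf_factor w u \<Longrightarrow> defect \<Theta> w \<le> defect \<Theta> (map u [i..<i + m])"
    using max_defect by blast
  show ?thesis
  proof (rule that[of m])
    fix e
    assume e: "inf_factor e u" "m < length e"
      and fr: "\<not> fresh (butlast e) (last e)" "\<not> fresh (butlast (\<Theta> e)) (last (\<Theta> e))"
    define Occ where "Occ j \<longleftrightarrow> i \<le> j \<and> (\<exists>e' \<in> {e, \<Theta> e}. occurs_at u e' j)" for j
    have "infinite {j. occurs_at u e j}" using rec e(1) by (simp add: recurrent_def)
    then obtain j0 where "i \<le> j0" "occurs_at u e j0"
      by (metis infinite_nat_iff_unbounded less_imp_le mem_Collect_eq)
    then have "Occ j0" by (auto simp: Occ_def)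
    define j where "j = (LEAST j. Occ j)"
    have j: "Occ j" unfolding j_def using \<open>Occ j0\<close> by (rule LeastI)
    have jmin: "j \<le> j'" if "Occ j'" for j' unfolding j_def using that by (rule Least_le)
    from j obtain e' where e': "e' \<in> {e, \<Theta> e}" "occurs_at u e' j" "i \<le> j" by (auto simp: Occ_def)
    have le: "length e' = length e" using e' by auto
    define k where "k = j + length e - 1"
    define x where "x = map u [i..<k]"
    \<comment> \<open>Since \<open>e\<close> is longer than \<open>m\<close>, its first occurrence
      ends beyond the slice of maximal defect, so that slice is a prefix of
      \<open>x\<close>.\<close>
    have k: "i + m \<le> k" "Suc k = j + length e" "j \<le> k" using e(2) e'(3) by (auto simp: k_def)
    have X: "x @ [u k] = map u [i..<j] @ e'"
    proof -
      have "x @ [u k] = map u [i..<Suc k]" using k(1) by (simp add: x_def)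
      also have "\<dots> = map u [i..<j] @ map u [j..<Suc k]"
        using k e' by (intro map_upt_split) auto
      finally show ?thesis using e' k le by (simp add: occurs_at_def)
    qed
    have no: "\<not> sublist d x" if "d \<in> {e, \<Theta> e}" for d
    proof
      assume "sublist d x"
      moreover have "i \<le> k" using k by simp
      ultimately obtain j' where j': "i \<le> j'" "j' + length d \<le> k" "d = map u [j'..<j' + length d]"
        unfolding x_def by (rule map_upt_sublistE)
      then have "Occ j'" using that by (auto simp: Occ_def occurs_at_def)
      then have "j \<le> j'" by (rule jmin)
      moreover have "length d = length e" using that by auto
      ultimately show False using j' k by simp
    qed
    have "e' \<noteq> []" using le e(2) by auto
    then have lb: "u k = last e'" "x = map u [i..<j] @ butlast e'"
      using X by (metis last_appendR last_snoc) (metis X \<open>e' \<noteq> []\<close> butlast_append butlast_snoc)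
    have "\<not> fresh (butlast e') (last e')" using fr e' by auto
    then have "\<not> fresh x (u k)"
      unfolding lb fresh_def by (meson sublist_append_leftI sublist_order.order_trans)
    \<comment> \<open>The defect is already maximal on a prefix of \<open>x\<close> and never falls
      under extension to the right, so the letter \<open>u k\<close> cannot raise it.\<close>
    moreover have "defect \<Theta> (x @ [u k]) \<le> defect \<Theta> x"
    proof -
      have "inf_factor (x @ [u k]) u"
        unfolding inf_factor_def occurs_at_def x_def using k(1)
        by (intro exI[of _ i]) simp
      then have "defect \<Theta> (x @ [u k]) \<le> defect \<Theta> (map u [i..<i + m])" by (rule mx)
      moreover have "x = map u [i..<i + m] @ map u [i + m..<k]"
        unfolding x_def using k(1) by (intro map_upt_split) auto
      then have "defect \<Theta> (map u [i..<i + m]) \<le> defect \<Theta> x"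
        by (simp only: defect_append_ge)
      ultimately show ?thesis by simp
    qed
    ultimately obtain p where "new_pal p (x @ [u k])" using ex_new_pal by blast
    moreover have "suffix e' (x @ [u k])" unfolding X by (rule suffixI) simp
    moreover have "\<not> sublist e (butlast (x @ [u k]))" "\<not> sublist (\<Theta> e) (butlast (x @ [u k]))"
      using no by auto
    ultimately show "\<exists>X e' p. e' \<in> {e, \<Theta> e} \<and> suffix e' X \<and> \<not> sublist e (butlast X) \<and>
            \<not> sublist (\<Theta> e) (butlast X) \<and> new_pal p X"
      using e'(1) by blast
  qed
qed

text \<open>The copy of \<open>w\<close> or \<open>\<Theta> w\<close> that starts \<open>e\<close>
  lies inside \<open>butlast e\<close>. It contains the last letter of \<open>e\<close> in the first
  case, the image of that letter in the second.\<close>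

lemma not_fresh_last:
  assumes "w \<noteq> []" "length w < length e" "suffix w e" "prefix w e \<or> prefix (\<Theta> w) e"
  shows "\<not> fresh (butlast e) (last e)"
proof -
  obtain w' where w: "w = w' @ [last e]"
    using assms(1,3) by (metis append_butlast_last_id last_appendR suffix_def)
  then have "sublist [last e] w" by (metis sublist_append_leftI)
  then have *: "sublist [last e] w" "sublist (\<Theta> [last e]) (\<Theta> w)"
    using sublist_image by blast+
  have "prefix w (butlast e) \<or> prefix (\<Theta> w) (butlast e)"
    using assms(2,4) prefix_butlast by auto
  with * show ?thesis unfolding fresh_def by (meson prefix_imp_sublist sublist_order.order_trans)
qed

text \<open>Take the shortest suffix \<open>e\<close> of \<open>X\<close> that is longer than
  \<open>w\<close> and begins with \<open>w\<close> or \<open>\<Theta> w\<close>: a complete return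
  up to \<open>\<Theta>\<close>. The first occurrence of \<open>e\<close> or
  \<open>\<Theta> e\<close> after a factor of maximal defect brings a new palindrome
  \<open>p\<close>. Comparing its length with those of \<open>w\<close> and \<open>e\<close> yields
  the suffix \<open>P\<close>, which is \<open>e\<close> or \<open>p\<close>.\<close>

lemma ex_longer_pal_suffix:
  obtains n where
    "\<And>X w. \<lbrakk>inf_factor X u; n < length w; suffix w X; sublist w (butlast X) \<or> sublist (\<Theta> w) (butlast X)\<rbrakk>
      \<Longrightarrow> \<exists>P. is_pal \<Theta> P \<and> suffix P X \<and> length w < length P"
proof -
  obtain n where n:
    "\<And>e. \<lbrakk>inf_factor e u; n < length e; \<not> fresh (butlast e) (last e); \<not> fresh (butlast (\<Theta> e)) (last (\<Theta> e))\<rbrakk>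
      \<Longrightarrow> \<exists>X e' p. e' \<in> {e, \<Theta> e} \<and> suffix e' X \<and> \<not> sublist e (butlast X) \<and>
            \<not> sublist (\<Theta> e) (butlast X) \<and> new_pal p X"
    using new_pal_at_first_occurrence by blast
  show ?thesis
  proof (rule that[of n])
    fix X w
    assume X: "inf_factor X u" and w: "n < length w" "suffix w X"
      and occ: "sublist w (butlast X) \<or> sublist (\<Theta> w) (butlast X)"
    \<comment> \<open>The strict inequality excludes \<open>e = w\<close>; the copies at the two
      ends of \<open>e\<close> may overlap.\<close>
    define C where "C e \<longleftrightarrow> suffix e X \<and> length w < length e \<and> (prefix w e \<or> prefix (\<Theta> w) e)" for e
    have "w \<noteq> []" using w by auto
    then have "X \<noteq> []" using w by auto
    obtain d where d: "d \<in> {w, \<Theta> w}" "sublist d (butlast X)" using occ by blast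
    then obtain q s where "butlast X = q @ d @ s" by (auto simp: sublist_def)
    then have "X = q @ (d @ s @ [last X])" using \<open>X \<noteq> []\<close>
      by (metis append_assoc append_butlast_last_id)
    then have "C (d @ s @ [last X])" using d(1) by (auto simp: C_def suffix_def)
    then obtain e where e: "C e" and min: "\<And>f. C f \<Longrightarrow> length e \<le> length f"
      using ex_has_least_nat[of C _ length] by blast
    have eX: "suffix e X" and we: "length w < length e" using e by (auto simp: C_def)
    have wsuf: "suffix w e" using eX w(2) we suffix_length_suffix by (metis less_imp_le)
    obtain d where d: "d \<in> {w, \<Theta> w}" "prefix d e" using e by (auto simp: C_def)
    have "inf_factor e u"
    proof -
      obtain i where "X = map u [i..<i + length X]" using X by (auto simp: inf_factor_def occurs_at_def)
      with eX have "suffix e (map u [i..<i + length X])" by simp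
      then obtain j where "j \<le> i + length X" "e = map u [j..<i + length X]"
        by (rule map_upt_suffixE) auto
      then show ?thesis unfolding inf_factor_def occurs_at_def by (intro exI[of _ j]) simp
    qed
    moreover have "n < length e" using we w by simp
    moreover have "\<not> fresh (butlast e) (last e)"
      using not_fresh_last[OF \<open>w \<noteq> []\<close> we wsuf] d by auto
    \<comment> \<open>The image \<open>\<Theta> e\<close> ends with \<open>\<Theta> d\<close> and
      begins with \<open>\<Theta> w\<close>, which is \<open>\<Theta> d\<close> or its image, so
      \<open>\<Theta> d\<close> takes the role of \<open>w\<close>.\<close>
    moreover have "\<not> fresh (butlast (\<Theta> e)) (last (\<Theta> e))"
    proof (rule not_fresh_last[of "\<Theta> d"])
      show "suffix (\<Theta> d) (\<Theta> e)" using d(2) by (rule prefix_imp_suffix)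
      show "prefix (\<Theta> d) (\<Theta> e) \<or> prefix (\<Theta> (\<Theta> d)) (\<Theta> e)"
        using suffix_imp_prefix[OF wsuf] d(1) by auto
      show "\<Theta> d \<noteq> []" using d(1) \<open>w \<noteq> []\<close> by (metis image_Nil insert_iff invol singletonD)
      show "length (\<Theta> d) < length (\<Theta> e)" using d(1) we by auto
    qed
    ultimately obtain Y e' p where e': "e' \<in> {e, \<Theta> e}" "suffix e' Y"
      and no: "\<not> sublist e (butlast Y)" "\<not> sublist (\<Theta> e) (butlast Y)" and p: "new_pal p Y"
      using n[of e] by blast
    have pal: "\<Theta> p = p" and pY: "suffix p Y" "\<not> sublist p (butlast Y)" and "p \<noteq> []"
      using p new_pal_not_Nil by (auto simp: new_pal_def is_pal_def)
    have le: "length e' = length e" using e'(1) by auto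
    then have "e' \<noteq> []" using we by auto
    obtain w' d' where wd: "w' \<in> {w, \<Theta> w}" "d' \<in> {w, \<Theta> w}" "suffix w' e'" "prefix d' e'"
      using e'(1) wsuf d suffix_imp_prefix[OF wsuf] prefix_imp_suffix[OF d(2)]
      by (metis insert_iff invol singletonD)
    then have lwd: "length w' = length w" "length d' = length w" by auto
    consider "length e' \<le> length p" | "length p \<le> length w" | "length w < length p" "length p < length e'"
      by linarith
    then show "\<exists>P. is_pal \<Theta> P \<and> suffix P X \<and> length w < length P"
    proof cases
      \<comment> \<open>Here \<open>p\<close> ends with \<open>e'\<close> and begins with
        \<open>\<Theta> e'\<close>. Were it longer than \<open>e'\<close>, then
        \<open>\<Theta> e'\<close> would occur too early; so \<open>p = e'\<close> and
        \<open>e\<close> is a palindrome.\<close>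
      case 1
      then have "suffix e' p" using e'(2) pY(1) suffix_length_suffix by blast
      then have pre: "prefix (\<Theta> e') p" using suffix_imp_prefix pal by metis
      have "p = e'"
      proof (rule ccontr)
        assume "p \<noteq> e'"
        then have "length e' < length p" using \<open>suffix e' p\<close> 1
          by (metis order_le_imp_less_or_eq suffix_order.eq_iff suffix_length_suffix)
        then have "prefix (\<Theta> e') (butlast p)" using pre prefix_butlast[of "\<Theta> e'" p] by simp
        then have "sublist (\<Theta> e') (butlast Y)"
          using suffix_butlast[OF pY(1) \<open>p \<noteq> []\<close>]
          by (meson prefix_imp_sublist suffix_imp_sublist sublist_order.order_trans)
        then show False using no e'(1) by auto
      qed
      then have "\<Theta> e = e" using pal e'(1) by auto
      then show ?thesis using eX we by (auto simp: is_pal_def)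
    next
      \<comment> \<open>A palindrome inside \<open>w'\<close> also lies inside
        \<open>\<Theta> w'\<close>, hence inside the copy \<open>d'\<close> that starts
        \<open>e'\<close>; this contradicts its being new.\<close>
      case 2
      have "suffix p w'"
      proof -
        have "suffix w' Y" using wd(3) e'(2) suffix_order.trans by blast
        then show ?thesis using pY(1) suffix_length_suffix 2 lwd by metis
      qed
      then have "sublist p w'" "sublist p (\<Theta> w')"
        using sublist_image[of p w'] pal by auto
      then have "sublist p d'" using wd(1,2) by auto
      moreover have "prefix d' (butlast e')" using wd(4) prefix_butlast le lwd we by metis
      ultimately have "sublist p (butlast Y)"
        using suffix_butlast[OF e'(2) \<open>e' \<noteq> []\<close>]
        by (meson prefix_imp_sublist suffix_imp_sublist sublist_order.order_trans)
      then show ?thesis using pY by blast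
    next
      \<comment> \<open>If \<open>e' = e\<close>, then \<open>p\<close> is the suffix sought.
        Otherwise \<open>p\<close> is a prefix of \<open>e\<close> ending with
        \<open>\<Theta> d\<close>.\<close>
      case 3
      then have pe: "suffix p e'" using e'(2) pY(1) suffix_length_suffix less_imp_le by metis
      show ?thesis
      proof (cases "e' = e")
        case True
        then have "suffix p X" using pe eX suffix_order.trans by blast
        then show ?thesis using 3 pal by (auto simp: is_pal_def)
      next
        case False
        then have e'': "e' = \<Theta> e" using e'(1) by simp
        then have "prefix p e" using suffix_imp_prefix[OF pe] pal by simp
        moreover have "suffix (\<Theta> d) p"
        proof -
          have "suffix (\<Theta> d) e'" using prefix_imp_suffix[OF d(2)] e'' by simp
          moreover have "length (\<Theta> d) \<le> length p" using d(1) 3 by auto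
          ultimately show ?thesis using pe suffix_length_suffix by blast
        qed
        ultimately obtain r s where rs: "p = r @ \<Theta> d" "e = r @ \<Theta> d @ s"
          by (auto simp: prefix_def suffix_def)
        have ld: "length d = length w" using d(1) by auto
        \<comment> \<open>This candidate is shorter than \<open>e\<close>, as \<open>r\<close> is
          nonempty when \<open>p\<close> is longer than \<open>w\<close>; minimality of
          \<open>e\<close> rules it out.\<close>
        have "C (\<Theta> d @ s)"
          unfolding C_def
        proof (intro conjI)
          show "suffix (\<Theta> d @ s) X" using eX rs(2) suffix_appendD by metis
          show "length w < length (\<Theta> d @ s)" using rs 3 le ld by simp
          show "prefix w (\<Theta> d @ s) \<or> prefix (\<Theta> w) (\<Theta> d @ s)" using d(1) by auto
        qed
        then have "length e \<le> length (\<Theta> d @ s)" by (rule min)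
        then show ?thesis using rs 3 ld by simp
      qed
    qed
  qed
qed

text \<open>The longest palindromic suffix of \<open>X\<close> is new: if it occurred earlier, the
  preceding lemma applied to it in place of \<open>w\<close> would give a longer one.\<close>

lemma ex_new_pal_suffix:
  obtains n where
    "\<And>X w. \<lbrakk>inf_factor X u; n < length w; suffix w X; sublist w (butlast X) \<or> sublist (\<Theta> w) (butlast X)\<rbrakk>
      \<Longrightarrow> \<exists>P. new_pal P X \<and> length w < length P"
proof -
  obtain n where n:
    "\<And>X w. \<lbrakk>inf_factor X u; n < length w; suffix w X; sublist w (butlast X) \<or> sublist (\<Theta> w) (butlast X)\<rbrakk>
      \<Longrightarrow> \<exists>P. is_pal \<Theta> P \<and> suffix P X \<and> length w < length P"
    using ex_longer_pal_suffix by blast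
  show ?thesis
  proof (rule that[of n])
    fix X w
    assume X: "inf_factor X u" and w: "n < length w" "suffix w X"
      and occ: "sublist w (butlast X) \<or> sublist (\<Theta> w) (butlast X)"
    let ?Q = "\<lambda>P. is_pal \<Theta> P \<and> suffix P X \<and> length w < length P"
    have "\<exists>P. ?Q P" using n[OF X w occ] .
    moreover have "\<forall>P. ?Q P \<longrightarrow> length P < Suc (length X)"
      using suffix_length_le by fastforce
    ultimately obtain P where P: "?Q P" and max: "\<And>P'. ?Q P' \<Longrightarrow> length P' \<le> length P"
      using ex_has_greatest_nat[of ?Q _ length] by blast
    have "\<not> sublist P (butlast X)"
    proof
      assume "sublist P (butlast X)"
      then obtain P' where "is_pal \<Theta> P'" "suffix P' X" "length P < length P'"
        using n[OF X, of P] P w by auto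
      then show False using max[of P'] P by simp
    qed
    then show "\<exists>P. new_pal P X \<and> length w < length P" using P by (auto simp: new_pal_def)
  qed
qed

end

section \<open>The block coding and its richness\<close>

lemma map_upt_eq_iff:
  "map u [i..<i + k] = map u [j..<j + k] \<longleftrightarrow> (\<forall>t<k. u (i + t) = u (j + t))"
  by (auto simp: list_eq_iff_nth_eq)

text \<open>Applying \<open>\<Theta>\<close> reverses the order of blocks and keeps their lengths.
  In a palindrome it therefore sends a block to the block at the mirrored position.\<close>

lemma (in antimorphism) pal_slice:
  assumes "\<Theta> (map u [j..<l]) = map u [j..<l]" "j \<le> s" "s + N \<le> l"
  shows "\<Theta> (map u [s..<s + N]) = map u [j + (l - s - N)..<j + (l - s - N) + N]"
proof -
  let ?r = "j + (l - s - N)"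
  have 1: "map u [j..<l] = map u [j..<s] @ map u [s..<s+N] @ map u [s+N..<l]"
    using assms map_upt_split[of j s l u] map_upt_split[of s "s+N" l u] by simp
  have "j \<le> ?r" "?r \<le> ?r + N" "?r + N \<le> l" using assms(2,3) by auto
  then have 2: "map u [j..<l] = map u [j..<?r] @ map u [?r..<?r+N] @ map u [?r+N..<l]"
    using map_upt_split[of j ?r l u] map_upt_split[of ?r "?r+N" l u] by (metis order_trans)
  have "\<Theta> (map u [s+N..<l]) @ \<Theta> (map u [s..<s+N]) @ \<Theta> (map u [j..<s]) =
        map u [j..<?r] @ map u [?r..<?r+N] @ map u [?r+N..<l]"
    using assms(1) unfolding 2[symmetric] by (simp add: 1 anti)
  moreover have "length (\<Theta> (map u [s+N..<l])) = length (map u [j..<?r])"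
    by simp
  ultimately have "\<Theta> (map u [s..<s+N]) @ \<Theta> (map u [j..<s]) = map u [?r..<?r+N] @ map u [?r+N..<l]"
    by (metis append_eq_append_conv)
  then show ?thesis
    by (rule append_eq_append_conv[THEN iffD1, THEN conjunct1, rotated]) simp
qed

theorem theorem1:
  fixes \<Theta>1 :: "('a::finite) list \<Rightarrow> 'a list" and u :: "nat \<Rightarrow> 'a"
  assumes "inv_antimorph UNIV \<Theta>1"
    and "recurrent u"
    and "finite_defect \<Theta>1 u"
  shows "\<exists>(B :: nat set) (\<Theta>2 :: nat list \<Rightarrow> nat list) (f :: nat \<Rightarrow> 'a list) (v :: nat \<Rightarrow> nat).
           finite B \<and> inv_antimorph B \<Theta>2 \<and> (\<forall>i. v i \<in> B) \<and>
           recurrent v \<and> morph_image_eq f v u \<and> rich_inf \<Theta>2 v"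
proof -
  interpret finite_defect_word \<Theta>1 u by unfold_locales (use assms in auto)
  obtain n where n:
    "\<And>X w. \<lbrakk>inf_factor X u; n < length w; suffix w X; sublist w (butlast X) \<or> sublist (\<Theta>1 w) (butlast X)\<rbrakk>
      \<Longrightarrow> \<exists>P. new_pal P X \<and> length w < length P"
    using ex_new_pal_suffix by blast
  \<comment> \<open>A single block is then longer than \<open>n\<close>, so the preceding result
    applies to it.\<close>
  define N where "N = Suc n"
  define B where "B = to_nat ` {w :: 'a list. length w = N}"
  \<comment> \<open>The identity outside \<open>B\<close> makes \<open>\<sigma>\<close> an
    involution on all naturals, so that \<open>\<Theta>2\<close> is an antimorphism over
    \<open>UNIV\<close> and the locale can be interpreted.\<close>
  define \<sigma> where "\<sigma> k = (if k \<in> B then to_nat (\<Theta>1 (from_nat k)) else k)" for k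
  define \<Theta>2 where "\<Theta>2 x = rev (map \<sigma> x)" for x
  define f where "f k = [hd (from_nat k :: 'a list)]" for k
  define v where "v i = to_nat (map u [i..<i + N])" for i
  have "finite {w :: 'a list. set w \<subseteq> UNIV \<and> length w = N}"
    by (rule finite_lists_length_eq) simp
  then have "finite B" by (simp add: B_def)
  have \<sigma>B: "\<sigma> (to_nat w) = to_nat (\<Theta>1 w)" if "length w = N" for w
    using that by (auto simp: \<sigma>_def B_def)
  have \<sigma>v: "\<sigma> (v i) = to_nat (\<Theta>1 (map u [i..<i + N]))" for i
    by (simp add: v_def \<sigma>B)
  have \<sigma>inv: "\<sigma> (\<sigma> k) = k" for k
  proof (cases "k \<in> B")
    case True
    then obtain w :: "'a list" where "k = to_nat w" "length w = N" by (auto simp: B_def)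
    then show ?thesis by (simp add: \<sigma>B)
  qed (simp add: \<sigma>_def)
  have \<sigma>mem: "\<sigma> k \<in> B" if "k \<in> B" for k
    using that by (auto simp: \<sigma>_def B_def)
  have "inv_antimorph UNIV \<Theta>2"
    by (simp add: inv_antimorph_def \<Theta>2_def rev_map \<sigma>inv o_def)
  then interpret V: antimorphism \<Theta>2 by unfold_locales
  have "inv_antimorph B \<Theta>2"
    unfolding inv_antimorph_def using V.invol V.anti \<sigma>mem by (auto simp: \<Theta>2_def)
  moreover have "\<forall>i. v i \<in> B" by (auto simp: v_def B_def)
  moreover have "recurrent v"
    unfolding recurrent_def
  proof (intro allI impI)
    fix w assume "inf_factor w v"
    then obtain i where i: "w = map v [i..<i + length w]" by (auto simp: inf_factor_def occurs_at_def)
    \<comment> \<open>Every block read by \<open>w\<close> lies inside this slice, so each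
      occurrence of it in \<open>u\<close> gives one of \<open>w\<close> in
      \<open>v\<close>.\<close>
    let ?W = "map u [i..<i + (length w + N)]"
    have "inf_factor ?W u" unfolding inf_factor_def occurs_at_def by (intro exI[of _ i]) simp
    then have "infinite {j. occurs_at u ?W j}" using assms(2) by (simp add: recurrent_def)
    moreover have "occurs_at v w j" if "occurs_at u ?W j" for j
    proof -
      have *: "u (i + t) = u (j + t)" if "t < length w + N" for t
        using \<open>occurs_at u ?W j\<close> that map_upt_eq_iff[of u i "length w + N" j]
        by (simp add: occurs_at_def)
      have "v (i + t) = v (j + t)" if "t < length w" for t
      proof -
        have "map u [i + t..<i + t + N] = map u [j + t..<j + t + N]"
          unfolding map_upt_eq_iff using * that by (simp add: add.assoc)
        then show ?thesis by (simp add: v_def)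
      qed
      then show ?thesis using i map_upt_eq_iff[of v i "length w" j] by (simp add: occurs_at_def)
    qed
    ultimately show "infinite {j. occurs_at v w j}"
      using infinite_super[of "{j. occurs_at u ?W j}" "{j. occurs_at v w j}"] by blast
  qed
  moreover have "morph_image_eq f v u"
  proof -
    have "f (v i) = [u i]" for i by (simp add: f_def v_def N_def upt_rec[of i])
    then have "concat (map f (map v [0..<m])) = map u [0..<m]" for m
      by (induction m) auto
    then show ?thesis unfolding morph_image_eq_def Let_def by auto
  qed
  moreover have "rich_inf \<Theta>2 v"
    unfolding rich_inf_def
  proof (intro allI impI)
    fix w assume "inf_factor w v"
    then obtain i where i: "w = map v [i..<i + length w]" by (auto simp: inf_factor_def occurs_at_def)
    have "defect \<Theta>2 (map v [i..<i + k]) = 0" for k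
    proof (induction k)
      case (Suc k)
      let ?x = "map v [i..<i + k]" and ?a = "v (i + k)"
      have "defect \<Theta>2 (?x @ [?a]) = defect \<Theta>2 ?x"
      proof (rule V.defect_snoc_eq)
        assume "\<not> V.fresh ?x ?a"
        \<comment> \<open>\<open>?X\<close> is the stretch of \<open>u\<close> covered by the blocks
          at \<open>i\<close> to \<open>i + k\<close>, and \<open>?w\<close> is the last of them. A
          letter that is not fresh means that \<open>?w\<close> or its image occurs earlier.\<close>
        let ?X = "map u [i..<i + k + N]" and ?w = "map u [i + k..<i + k + N]"
        have bX: "butlast ?X = map u [i..<i + k + n]" by (simp add: N_def)
        obtain j where j: "i \<le> j" "j < i + k" "v j = ?a \<or> v j = \<sigma> ?a"
          using \<open>\<not> V.fresh ?x ?a\<close> by (auto simp: V.fresh_def sublist_single \<Theta>2_def)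
        then have "map u [j..<j + N] = ?w \<or> map u [j..<j + N] = \<Theta>1 ?w"
          by (auto simp: \<sigma>v) (auto simp: v_def)
        moreover have "sublist (map u [j..<j + N]) (butlast ?X)"
          unfolding bX by (rule map_upt_sublist) (use j in \<open>auto simp: N_def\<close>)
        ultimately have "sublist ?w (butlast ?X) \<or> sublist (\<Theta>1 ?w) (butlast ?X)" by metis
        moreover have "inf_factor ?X u"
          unfolding inf_factor_def occurs_at_def by (intro exI[of _ i]) (simp add: add.assoc)
        moreover have "suffix ?w ?X"
          using suffixI[OF map_upt_split[of i "i + k" "i + k + N" u]] by simp
        ultimately obtain P where P: "new_pal P ?X" "N < length P"
          using n[of ?X ?w] by (auto simp: N_def)
        then have "suffix P ?X" by (simp add: new_pal_def)
        then obtain j where j: "i \<le> j" "j \<le> i + k + N" "P = map u [j..<i + k + N]"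
          by (rule map_upt_suffixE) auto
        then have jk: "j < i + k" using P(2) by simp
        \<comment> \<open>These are exactly the blocks that lie inside \<open>P\<close>; since
          \<open>P\<close> is longer than \<open>N\<close>, there are at least two.\<close>
        let ?p = "map v [j..<Suc (i + k)]"
        have "V.new_pal ?p (?x @ [?a])"
          unfolding V.new_pal_def
        proof (intro conjI)
          show "suffix ?p (?x @ [?a])"
            using map_upt_split[of i j "Suc (i + k)" v] j jk by (simp add: suffix_def)
          have "\<Theta>1 P = P" using P by (simp add: new_pal_def is_pal_def)
          then have *: "\<Theta>1 (map u [s..<s + N]) = map u [j + (i + k - s)..<j + (i + k - s) + N]"
            if "j \<le> s" "s \<le> i + k" for s
            using pal_slice[of u j "i + k + N" s N] that j(3) by simp
          have "\<Theta>2 ?p ! t = ?p ! t" if "t < Suc (i + k) - j" for t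
          proof -
            have "\<Theta>2 ?p ! t = \<sigma> (v (i + k - t))"
              using that by (simp add: \<Theta>2_def rev_nth del: upt_Suc)
            also have "\<dots> = v (j + t)"
              using *[of "i + k - t"] that by (simp add: \<sigma>v) (simp add: v_def)
            also have "\<dots> = ?p ! t" using that by (simp del: upt_Suc)
            finally show ?thesis .
          qed
          then show "is_pal \<Theta>2 ?p"
            unfolding is_pal_def by (intro nth_equalityI) (auto simp del: upt_Suc)
          show "\<not> sublist ?p (butlast (?x @ [?a]))"
          proof
            \<comment> \<open>Overlapping blocks determine the letters they cover, so an earlier
              copy of \<open>?p\<close> would give an earlier copy of \<open>P\<close>.\<close>
            assume "sublist ?p (butlast (?x @ [?a]))"
            then have "sublist ?p (map v [i..<i + k])" by simp
            moreover have "i \<le> i + k" by simp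
            ultimately obtain j' where j': "i \<le> j'" "j' + length ?p \<le> i + k"
              "?p = map v [j'..<j' + length ?p]"
              by (rule map_upt_sublistE)
            let ?L = "Suc (i + k) - j"
            have vv: "v (j + t) = v (j' + t)" if "t < ?L" for t
              using j'(3) that map_upt_eq_iff[of v j ?L j'] jk by (simp del: upt_Suc)
            have uu: "u (j + s + r) = u (j' + s + r)" if "s < ?L" "r < N" for s r
              using vv[OF that(1)] that(2) map_upt_eq_iff[of u "j + s" N "j' + s"]
              by (simp add: v_def)
            have "u (j + t) = u (j' + t)" if "t < ?L + n" for t
            proof (cases "t < ?L")
              case True
              then show ?thesis using uu[of t 0] by (simp add: N_def)
            next
              case False
              \<comment> \<open>Letters beyond the last block start are read inside the last block,
                which starts at offset \<open>?L - 1\<close>.\<close>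
              then have "u (j + (?L - 1) + (t - (?L - 1))) = u (j' + (?L - 1) + (t - (?L - 1)))"
                using that jk by (intro uu) (auto simp: N_def)
              moreover have "?L - 1 + (t - (?L - 1)) = t" using False by simp
              ultimately show ?thesis by (metis add.assoc)
            qed
            then have "map u [j..<j + (?L + n)] = map u [j'..<j' + (?L + n)]"
              by (simp add: map_upt_eq_iff)
            moreover have "j + (?L + n) = i + k + N" using jk by (simp add: N_def)
            ultimately have "P = map u [j'..<j' + (?L + n)]" using j(3) by simp
            moreover have "sublist (map u [j'..<j' + (?L + n)]) (butlast ?X)"
              unfolding bX by (rule map_upt_sublist) (use j' in \<open>auto simp del: upt_Suc\<close>)
            ultimately show False using P by (simp add: new_pal_def)
          qed
        qed
        then show "\<exists>p. V.new_pal p (?x @ [?a])" by blast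
      qed
      then show ?case using Suc by simp
    qed simp
    then show "defect \<Theta>2 w = 0" using i by metis
  qed
  ultimately show ?thesis using \<open>finite B\<close> by blast
qed

end
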